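(* Every Artinian commutative ring with identity satisfies the $\ast$-property.
   Context: A ring $R$ is said to satisfy the $\ast$-property if for every family $\{I_\alpha\}_{\alpha\in S}$ of ideals of $R$ (with $S$ an arbitrary index set) there exists a finite subset $S'\subseteq S$ such that $\sqrt{\bigcap_{\alpha\in S} I_\alpha}=\bigcap_{\alpha\in S'}\sqrt{I_\alpha}$, where $\sqrt{I}$ denotes the radical of the ideal $I$. *)

theory Defs
  imports "HOL-Algebra.Ideal"
begin

locale artinian_cring = cring R for R (structure) +
  assumes descending_chain_condition:
    "\<And>I :: nat \<Rightarrow> _ set. \<lbrakk> \<And>n. ideal (I n) R; \<And>n. I (Suc n) \<subseteq> I n \<rbrakk> \<Longrightarrow> \<exists>N. \<forall>n\<ge>N. I n = I N"

definition radical :: "('a, 'b) ring_scheme \<Rightarrow> 'a set \<Rightarrow> 'a set"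
  where "radical R I = {x \<in> carrier R. \<exists>n::nat. n > 0 \<and> x [^]\<^bsub>R\<^esub> n \<in> I}"

(* Intersecting with the carrier makes the intersection of the empty family the whole ring
   instead of UNIV. The index sets S are the subsets of a type 'i; definitions cannot quantify
   over types, so 'i is a parameter, and results about arbitrary index sets leave it free. *)
definition star_property :: "'i itself \<Rightarrow> ('a, 'b) ring_scheme \<Rightarrow> bool"
  where "star_property (_ :: 'i itself) R \<longleftrightarrow>
    (\<forall>(S :: 'i set) (I :: 'i \<Rightarrow> 'a set). (\<forall>\<alpha>\<in>S. ideal (I \<alpha>) R) \<longrightarrow>
      (\<exists>S'\<subseteq>S. finite S' \<and>
        radical R (carrier R \<inter> (\<Inter>\<alpha>\<in>S. I \<alpha>)) = carrier R \<inter> (\<Inter>\<alpha>\<in>S'. radical R (I \<alpha>))))"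

end

(* By the descending chain condition some finite intersection of members of the family is minimal
   among the finite intersections, hence equal to the full intersection; and the radical
   commutes with finite intersections. *)
theory Submission
  imports Defs
begin

context artinian_cring
begin

text \<open>The chain condition in the form that yields minimal elements. Both sides are restricted
  to ideals because the condition says nothing about chains of other subsets.\<close>

lemma wf_ideal_psubset: "wf {(I, J). ideal I R \<and> ideal J R \<and> I \<subset> J}"
  unfolding wf_iff_no_infinite_down_chain
proof
  assume "\<exists>f. \<forall>i. (f (Suc i), f i) \<in> {(I, J). ideal I R \<and> ideal J R \<and> I \<subset> J}"
  then obtain f where "\<forall>i. ideal (f (Suc i)) R \<and> ideal (f i) R \<and> f (Suc i) \<subset> f i"
    by auto
  then have f: "\<And>i. ideal (f i) R" "\<And>i. f (Suc i) \<subset> f i"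
    by blast+
  then obtain N where N: "\<forall>n\<ge>N. f n = f N"
    using descending_chain_condition[of f] by blast
  \<comment> \<open>A strictly descending chain cannot stabilise, not even for one step after
    \<open>N\<close>.\<close>
  have "f (Suc N) = f N"
    by (rule N[rule_format]) simp
  with f(2)[of N] show False
    by simp
qed

lemma minimal_ideal_exists:
  assumes "A \<in> F" and ideals: "\<And>I. I \<in> F \<Longrightarrow> ideal I R"
  shows "\<exists>I\<in>F. \<forall>J\<in>F. \<not> J \<subset> I"
proof -
  obtain I where I: "I \<in> F"
    and min: "\<And>J. (J, I) \<in> {(I, J). ideal I R \<and> ideal J R \<and> I \<subset> J} \<Longrightarrow> J \<notin> F"
    using wfE_min[OF wf_ideal_psubset \<open>A \<in> F\<close>] by (metis (lifting))
  have "\<not> J \<subset> I" if "J \<in> F" for J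
    using min[of J] that ideals I by auto
  with I show ?thesis
    by (intro bexI[of _ I]) simp_all
qed

end

context cring
begin

lemma ideal_Inter_finite:
  assumes "finite S" and "\<And>\<alpha>. \<alpha> \<in> S \<Longrightarrow> ideal (I \<alpha>) R"
  shows "ideal (carrier R \<inter> (\<Inter>\<alpha>\<in>S. I \<alpha>)) R"
  using assms
proof (induction S)
  case empty
  then show ?case by (simp add: oneideal)
next
  case (insert \<beta> S)
  have "ideal (carrier R \<inter> (\<Inter>\<alpha>\<in>S. I \<alpha>)) R"
    using insert by blast
  with insert.prems have "ideal (I \<beta> \<inter> (carrier R \<inter> (\<Inter>\<alpha>\<in>S. I \<alpha>))) R"
    by (simp add: i_intersect)
  then show ?case
    by (simp add: Int_left_commute)
qed

lemma radical_carrier: "radical R (carrier R) = carrier R"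
  unfolding radical_def by auto

text \<open>If \<open>x [^] m\<close> lies in \<open>I\<close> and \<open>x [^] n\<close> in
  \<open>J\<close>, their product lies in both ideals by absorption, so the exponent
  \<open>m + n\<close> serves for the intersection.\<close>

lemma radical_Int:
  assumes "ideal I R" and "ideal J R"
  shows "radical R (I \<inter> J) = radical R I \<inter> radical R J"
proof
  show "radical R (I \<inter> J) \<subseteq> radical R I \<inter> radical R J"
    unfolding radical_def by auto
  show "radical R I \<inter> radical R J \<subseteq> radical R (I \<inter> J)"
  proof
    fix x assume "x \<in> radical R I \<inter> radical R J"
    then obtain m n :: nat where x: "x \<in> carrier R" and m: "m > 0" "x [^] m \<in> I"
      and n: "x [^] n \<in> J"
      unfolding radical_def by auto
    have "x [^] m \<otimes> x [^] n \<in> I \<inter> J"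
      using assms x m n by (auto intro: ideal.I_l_closed ideal.I_r_closed)
    then have "x [^] (m + n) \<in> I \<inter> J"
      using x by (simp add: nat_pow_mult)
    \<comment> \<open>The exponent \<open>m + n\<close> is positive because \<open>m\<close>
      is.\<close>
    then show "x \<in> radical R (I \<inter> J)"
      unfolding radical_def using x m(1) by blast
  qed
qed

text \<open>Induction from the binary case. Each step adds exponents, so the argument is confined to
  finite families: over an infinite one the exponents may be unbounded.\<close>

lemma radical_Inter_finite:
  assumes "finite S" and "\<And>\<alpha>. \<alpha> \<in> S \<Longrightarrow> ideal (I \<alpha>) R"
  shows "radical R (carrier R \<inter> (\<Inter>\<alpha>\<in>S. I \<alpha>)) = carrier R \<inter> (\<Inter>\<alpha>\<in>S. radical R (I \<alpha>))"
  using assms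
proof (induction S)
  case empty
  then show ?case by (simp add: radical_carrier)
next
  case (insert \<beta> S)
  have "ideal (carrier R \<inter> (\<Inter>\<alpha>\<in>S. I \<alpha>)) R"
    using insert by (intro ideal_Inter_finite) auto
  then have "radical R (I \<beta> \<inter> (carrier R \<inter> (\<Inter>\<alpha>\<in>S. I \<alpha>)))
      = radical R (I \<beta>) \<inter> (carrier R \<inter> (\<Inter>\<alpha>\<in>S. radical R (I \<alpha>)))"
    using insert by (simp add: radical_Int)
  then show ?case
    by (simp add: Int_left_commute)
qed

end

lemma (in artinian_cring) Inter_eq_finite_Inter:
  assumes "\<And>\<alpha>. \<alpha> \<in> S \<Longrightarrow> ideal (I \<alpha>) R"
  obtains S' where "S' \<subseteq> S" and "finite S'"
    and "carrier R \<inter> (\<Inter>\<alpha>\<in>S. I \<alpha>) = carrier R \<inter> (\<Inter>\<alpha>\<in>S'. I \<alpha>)"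
proof -
  define K where "K T = carrier R \<inter> (\<Inter>\<alpha>\<in>T. I \<alpha>)" for T
  define F where "F = K ` {T. T \<subseteq> S \<and> finite T}"
  \<comment> \<open>The empty subfamily, whose intersection is the carrier, makes \<open>F\<close>
    nonempty even if \<open>S\<close> is empty.\<close>
  have "K {} \<in> F"
    unfolding F_def by blast
  moreover have "ideal J R" if "J \<in> F" for J
    using that assms unfolding F_def K_def by (auto intro!: ideal_Inter_finite)
  ultimately have "\<exists>J\<in>F. \<forall>L\<in>F. \<not> L \<subset> J"
    by (rule minimal_ideal_exists)
  then obtain J where "J \<in> F" and J_min: "\<forall>L\<in>F. \<not> L \<subset> J" ..
  from this(1) obtain S' where S': "S' \<subseteq> S" "finite S'" and J: "J = K S'"
    unfolding F_def by blast
  \<comment> \<open>Adjoining \<open>\<beta>\<close> to \<open>S'\<close> gives another member of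
    \<open>F\<close>, contained in \<open>K S'\<close>. By minimality it is not strictly smaller, so
    intersecting with \<open>I \<beta>\<close> removes nothing.\<close>
  have "K S' \<subseteq> I \<beta>" if "\<beta> \<in> S" for \<beta>
  proof -
    have "K (insert \<beta> S') \<in> F"
      unfolding F_def using S' that by blast
    moreover have "K (insert \<beta> S') = I \<beta> \<inter> K S'"
      unfolding K_def by auto
    ultimately show ?thesis
      using J_min J by blast
  qed
  \<comment> \<open>The inclusion of \<open>K S\<close> in \<open>K S'\<close> comes from
    \<open>S' \<subseteq> S\<close>, the other one from the previous step.\<close>
  then have "K S = K S'"
    using S'(1) unfolding K_def by blast
  with S' show thesis
    using that unfolding K_def by blast
qed

theorem corollary1:
  fixes R :: "('a, 'b) ring_scheme"
  assumes "artinian_cring R"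
  shows "star_property TYPE('i) R"
  unfolding star_property_def
proof (intro allI impI)
  interpret artinian_cring R by fact
  fix S :: "'i set" and I :: "'i \<Rightarrow> 'a set"
  assume ideals: "\<forall>\<alpha>\<in>S. ideal (I \<alpha>) R"
  then obtain S' where S': "S' \<subseteq> S" "finite S'"
    and eq: "carrier R \<inter> (\<Inter>\<alpha>\<in>S. I \<alpha>) = carrier R \<inter> (\<Inter>\<alpha>\<in>S'. I \<alpha>)"
    using Inter_eq_finite_Inter[of S I] by blast
  \<comment> \<open>By \<open>eq\<close> the radical is now taken of a finite intersection, where it
    can be moved inside.\<close>
  have "radical R (carrier R \<inter> (\<Inter>\<alpha>\<in>S'. I \<alpha>)) = carrier R \<inter> (\<Inter>\<alpha>\<in>S'. radical R (I \<alpha>))"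
    using S' ideals by (intro radical_Inter_finite) auto
  with S' eq show "\<exists>S'\<subseteq>S. finite S' \<and>
      radical R (carrier R \<inter> (\<Inter>\<alpha>\<in>S. I \<alpha>)) = carrier R \<inter> (\<Inter>\<alpha>\<in>S'. radical R (I \<alpha>))"
    by metis
qed

end
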